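(* Let $(T,\mu,\eta)$ be an ordered saturation monad on $\mathsf{C}$ such that every hom-set of $\mathcal{K}l(T)$ has finite joins, and such that for all $\alpha:X\rightsquigarrow X$, all $f:X\rightsquigarrow Y$ in $\mathcal{K}l(T)$ and all $\beta:Y\rightsquigarrow Y$: $f\cdot\alpha\le\beta\cdot f$ implies $f\cdot\alpha^*\le\beta^*\cdot f$, and $f\cdot\alpha\ge\beta\cdot f$ implies $f\cdot\alpha^*\ge\beta^*\cdot f$. Then for every $\alpha:X\rightsquigarrow X$, $\alpha^*$ is the least fixed point of the map $x\mapsto 1_X\vee x\cdot\alpha$ on $Hom_{\mathcal{K}l(T)}(X,X)$; that is, $\alpha^*=1_X\vee\alpha^*\cdot\alpha$ and $\alpha^*\le\gamma$ for every $\gamma$ with $\gamma=1_X\vee\gamma\cdot\alpha$.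
   Context: Kleisli category $\mathcal{K}l(T)$: morphisms $X\rightsquigarrow Y$ are morphisms $X\to TY$, composition $g\cdot f=\mu_Z\circ Tg\circ f$, identity $1_X=\eta_X$; $f^\sharp=\eta_Y\circ f$ for $f$ in $\mathsf{C}$. Order enriched: hom-sets are posets and composition is monotone. Ordered saturation monad: $\mathcal{K}l(T)$ order enriched and for each $\alpha:X\rightsquigarrow X$ there is $\alpha^*$ with (1) $1\le\alpha^*$; (2) $\alpha\le\alpha^*$; (3) $\alpha^*\cdot\alpha^*\le\alpha^*$; (4) $\alpha^*\le\beta$ whenever $1\le\beta$, $\alpha\le\beta$, $\beta\cdot\beta\le\beta$; (5) for $f:X\to Y$ in $\mathsf{C}$ and $\beta:Y\rightsquigarrow Y$, $f^\sharp\cdot\alpha\le\beta\cdot f^\sharp\Rightarrow f^\sharp\cdot\alpha^*\le\beta^*\cdot f^\sharp$, and likewise with $\ge$. *)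

theory Defs
  imports "HOL-Algebra.Complete_Lattice"
begin

record ('o, 'a) cat_data =
  Obj :: "'o set"
  Arr :: "'a set"
  Dom :: "'a \<Rightarrow> 'o"
  Cod :: "'a \<Rightarrow> 'o"
  Id :: "'o \<Rightarrow> 'a"
  Comp :: "'a \<Rightarrow> 'a \<Rightarrow> 'a"

definition Hom :: "('o, 'a) cat_data \<Rightarrow> 'o \<Rightarrow> 'o \<Rightarrow> 'a set"
  where "Hom C X Y = {f \<in> Arr C. Dom C f = X \<and> Cod C f = Y}"

locale category =
  fixes C :: "('o, 'a) cat_data"
  assumes Dom_Obj: "f \<in> Arr C \<Longrightarrow> Dom C f \<in> Obj C"
    and Cod_Obj: "f \<in> Arr C \<Longrightarrow> Cod C f \<in> Obj C"
    and Id_Hom: "X \<in> Obj C \<Longrightarrow> Id C X \<in> Hom C X X"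
    and Comp_Hom: "\<lbrakk>f \<in> Hom C X Y; g \<in> Hom C Y Z\<rbrakk> \<Longrightarrow> Comp C g f \<in> Hom C X Z"
    and Comp_Id: "f \<in> Hom C X Y \<Longrightarrow> Comp C f (Id C X) = f"
    and Id_Comp: "f \<in> Hom C X Y \<Longrightarrow> Comp C (Id C Y) f = f"
    and Comp_assoc: "\<lbrakk>f \<in> Hom C W X; g \<in> Hom C X Y; h \<in> Hom C Y Z\<rbrakk>
          \<Longrightarrow> Comp C (Comp C h g) f = Comp C h (Comp C g f)"

record ('o, 'a) monad_data =
  FObj :: "'o \<Rightarrow> 'o"
  FArr :: "'a \<Rightarrow> 'a"
  Unit :: "'o \<Rightarrow> 'a"
  Mult :: "'o \<Rightarrow> 'a"

locale monad = category C for C :: "('o, 'a) cat_data" +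
  fixes T :: "('o, 'a) monad_data"
  assumes FObj_Obj: "X \<in> Obj C \<Longrightarrow> FObj T X \<in> Obj C"
    and FArr_Hom: "f \<in> Hom C X Y \<Longrightarrow> FArr T f \<in> Hom C (FObj T X) (FObj T Y)"
    and FArr_Id: "X \<in> Obj C \<Longrightarrow> FArr T (Id C X) = Id C (FObj T X)"
    and FArr_Comp: "\<lbrakk>f \<in> Hom C X Y; g \<in> Hom C Y Z\<rbrakk>
          \<Longrightarrow> FArr T (Comp C g f) = Comp C (FArr T g) (FArr T f)"
    and Unit_Hom: "X \<in> Obj C \<Longrightarrow> Unit T X \<in> Hom C X (FObj T X)"
    and Mult_Hom: "X \<in> Obj C \<Longrightarrow> Mult T X \<in> Hom C (FObj T (FObj T X)) (FObj T X)"
    and Unit_natural: "f \<in> Hom C X Y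
          \<Longrightarrow> Comp C (Unit T Y) f = Comp C (FArr T f) (Unit T X)"
    and Mult_natural: "f \<in> Hom C X Y
          \<Longrightarrow> Comp C (Mult T Y) (FArr T (FArr T f)) = Comp C (FArr T f) (Mult T X)"
    and Mult_FArr_Unit: "X \<in> Obj C
          \<Longrightarrow> Comp C (Mult T X) (FArr T (Unit T X)) = Id C (FObj T X)"
    and Mult_Unit: "X \<in> Obj C
          \<Longrightarrow> Comp C (Mult T X) (Unit T (FObj T X)) = Id C (FObj T X)"
    and Mult_assoc: "X \<in> Obj C
          \<Longrightarrow> Comp C (Mult T X) (FArr T (Mult T X)) = Comp C (Mult T X) (Mult T (FObj T X))"

definition kl_Hom :: "('o, 'a) cat_data \<Rightarrow> ('o, 'a) monad_data \<Rightarrow> 'o \<Rightarrow> 'o \<Rightarrow> 'a set"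
  where "kl_Hom C T X Y = Hom C X (FObj T Y)"

text \<open>The codomain \<open>Z\<close> of the second arrow is an explicit argument, because it cannot be
  recovered from the object \<open>FObj T Z\<close> when the functor is not injective on objects.\<close>

definition kl_comp ::
    "('o, 'a) cat_data \<Rightarrow> ('o, 'a) monad_data \<Rightarrow> 'o \<Rightarrow> 'a \<Rightarrow> 'a \<Rightarrow> 'a"
  where "kl_comp C T Z g f = Comp C (Mult T Z) (Comp C (FArr T g) f)"

definition kl_id :: "('o, 'a) monad_data \<Rightarrow> 'o \<Rightarrow> 'a"
  where "kl_id T X = Unit T X"

definition sharp ::
    "('o, 'a) cat_data \<Rightarrow> ('o, 'a) monad_data \<Rightarrow> 'o \<Rightarrow> 'a \<Rightarrow> 'a"
  where "sharp C T Y f = Comp C (Unit T Y) f"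

context monad
begin

lemma kl_id_Hom: "X \<in> Obj C \<Longrightarrow> kl_id T X \<in> kl_Hom C T X X"
  by (simp add: kl_id_def kl_Hom_def Unit_Hom)

lemma kl_comp_Hom:
  assumes "Z \<in> Obj C" "f \<in> kl_Hom C T X Y" "g \<in> kl_Hom C T Y Z"
  shows "kl_comp C T Z g f \<in> kl_Hom C T X Z"
  using assms unfolding kl_comp_def kl_Hom_def by (blast intro: Comp_Hom FArr_Hom Mult_Hom)

lemma kl_comp_id:
  assumes "X \<in> Obj C" "Y \<in> Obj C" "f \<in> kl_Hom C T X Y"
  shows "kl_comp C T Y f (kl_id T X) = f"
proof -
  have f: "f \<in> Hom C X (FObj T Y)" using assms by (simp add: kl_Hom_def)
  have "Comp C (Mult T Y) (Comp C (Unit T (FObj T Y)) f)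
      = Comp C (Comp C (Mult T Y) (Unit T (FObj T Y))) f"
    using Comp_assoc[OF f Unit_Hom Mult_Hom] assms FObj_Obj by simp
  then show ?thesis
    using f assms by (simp add: kl_comp_def kl_id_def Unit_natural[OF f, symmetric] Mult_Unit Id_Comp)
qed

lemma kl_id_comp:
  assumes "X \<in> Obj C" "Y \<in> Obj C" "f \<in> kl_Hom C T X Y"
  shows "kl_comp C T Y (kl_id T Y) f = f"
proof -
  have f: "f \<in> Hom C X (FObj T Y)" using assms by (simp add: kl_Hom_def)
  have "Comp C (Mult T Y) (Comp C (FArr T (Unit T Y)) f)
      = Comp C (Comp C (Mult T Y) (FArr T (Unit T Y))) f"
    using Comp_assoc[OF f FArr_Hom[OF Unit_Hom] Mult_Hom] assms by simp
  then show ?thesis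
    using f assms by (simp add: kl_comp_def kl_id_def Mult_FArr_Unit Id_Comp)
qed

lemma kl_comp_assoc:
  assumes "Y \<in> Obj C" "Z \<in> Obj C"
    and "f \<in> kl_Hom C T W X" "g \<in> kl_Hom C T X Y" "h \<in> kl_Hom C T Y Z"
  shows "kl_comp C T Z (kl_comp C T Z h g) f = kl_comp C T Z h (kl_comp C T Y g f)"
proof -
  let ?c = "Comp C" and ?F = "FArr T" and ?m = "Mult T"
  have f: "f \<in> Hom C W (FObj T X)" and g: "g \<in> Hom C X (FObj T Y)"
    and h: "h \<in> Hom C Y (FObj T Z)" using assms by (simp_all add: kl_Hom_def)
  have TZ: "FObj T Z \<in> Obj C" using assms FObj_Obj by blast
  note Fg = FArr_Hom[OF g] and Fh = FArr_Hom[OF h]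
  note FFh = FArr_Hom[OF Fh] and mY = Mult_Hom[OF assms(1)] and mZ = Mult_Hom[OF assms(2)]
  note FmZ = FArr_Hom[OF mZ] and mTZ = Mult_Hom[OF TZ]
  note Fgf = Comp_Hom[OF f Fg]
  have "?F (?c (?m Z) (?c (?F h) g)) = ?c (?F (?m Z)) (?c (?F (?F h)) (?F g))"
    using FArr_Comp[OF Comp_Hom[OF g Fh] mZ] FArr_Comp[OF g Fh] by simp
  then have "?c (?F (?c (?m Z) (?c (?F h) g))) f = ?c (?F (?m Z)) (?c (?F (?F h)) (?c (?F g) f))"
    using Comp_assoc[OF f Comp_Hom[OF Fg FFh] FmZ] Comp_assoc[OF f Fg FFh] by simp
  then have "?c (?m Z) (?c (?F (?c (?m Z) (?c (?F h) g))) f)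
      = ?c (?c (?m Z) (?m (FObj T Z))) (?c (?F (?F h)) (?c (?F g) f))"
    using Comp_assoc[OF Comp_Hom[OF Fgf FFh] FmZ mZ] Mult_assoc[OF assms(2)] by simp
  also have "\<dots> = ?c (?m Z) (?c (?c (?m (FObj T Z)) (?F (?F h))) (?c (?F g) f))"
    using Comp_assoc[OF Comp_Hom[OF Fgf FFh] mTZ mZ] Comp_assoc[OF Fgf FFh mTZ] by simp
  also have "\<dots> = ?c (?m Z) (?c (?F h) (?c (?m Y) (?c (?F g) f)))"
    using Mult_natural[OF h] Comp_assoc[OF Fgf mY Fh] by simp
  finally show ?thesis by (simp add: kl_comp_def)
qed

end

text \<open>\<open>K X Y\<close> is the Kleisli hom-set from \<open>X\<close> to \<open>Y\<close> together with its order.\<close>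

locale order_enriched_monad = monad C T
  for C :: "('o, 'a) cat_data" and T :: "('o, 'a) monad_data" +
  fixes K :: "'o \<Rightarrow> 'o \<Rightarrow> 'a gorder"
  assumes K_carrier: "\<lbrakk>X \<in> Obj C; Y \<in> Obj C\<rbrakk> \<Longrightarrow> carrier (K X Y) = kl_Hom C T X Y"
    and K_partial_order: "\<lbrakk>X \<in> Obj C; Y \<in> Obj C\<rbrakk> \<Longrightarrow> partial_order (K X Y)"
    and kl_comp_mono: "\<lbrakk>X \<in> Obj C; Y \<in> Obj C; Z \<in> Obj C;
          f \<in> kl_Hom C T X Y; f' \<in> kl_Hom C T X Y; g \<in> kl_Hom C T Y Z; g' \<in> kl_Hom C T Y Z;
          f \<sqsubseteq>\<^bsub>K X Y\<^esub> f'; g \<sqsubseteq>\<^bsub>K Y Z\<^esub> g'\<rbrakk>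
          \<Longrightarrow> kl_comp C T Z g f \<sqsubseteq>\<^bsub>K X Z\<^esub> kl_comp C T Z g' f'"

text \<open>\<open>star X \<alpha>\<close> is \<open>\<alpha>\<^sup>*\<close> for \<open>\<alpha>\<close> in \<open>K X X\<close>; the first five axioms determine it uniquely.\<close>

locale ordered_saturation_monad = order_enriched_monad C T K
  for C :: "('o, 'a) cat_data" and T :: "('o, 'a) monad_data" and K :: "'o \<Rightarrow> 'o \<Rightarrow> 'a gorder" +
  fixes star :: "'o \<Rightarrow> 'a \<Rightarrow> 'a"
  assumes star_Hom: "\<lbrakk>X \<in> Obj C; \<alpha> \<in> kl_Hom C T X X\<rbrakk> \<Longrightarrow> star X \<alpha> \<in> kl_Hom C T X X"
    and star_refl: "\<lbrakk>X \<in> Obj C; \<alpha> \<in> kl_Hom C T X X\<rbrakk> \<Longrightarrow> kl_id T X \<sqsubseteq>\<^bsub>K X X\<^esub> star X \<alpha>"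
    and star_ext: "\<lbrakk>X \<in> Obj C; \<alpha> \<in> kl_Hom C T X X\<rbrakk> \<Longrightarrow> \<alpha> \<sqsubseteq>\<^bsub>K X X\<^esub> star X \<alpha>"
    and star_trans: "\<lbrakk>X \<in> Obj C; \<alpha> \<in> kl_Hom C T X X\<rbrakk>
          \<Longrightarrow> kl_comp C T X (star X \<alpha>) (star X \<alpha>) \<sqsubseteq>\<^bsub>K X X\<^esub> star X \<alpha>"
    and star_least: "\<lbrakk>X \<in> Obj C; \<alpha> \<in> kl_Hom C T X X; \<beta> \<in> kl_Hom C T X X;
          kl_id T X \<sqsubseteq>\<^bsub>K X X\<^esub> \<beta>; \<alpha> \<sqsubseteq>\<^bsub>K X X\<^esub> \<beta>; kl_comp C T X \<beta> \<beta> \<sqsubseteq>\<^bsub>K X X\<^esub> \<beta>\<rbrakk>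
          \<Longrightarrow> star X \<alpha> \<sqsubseteq>\<^bsub>K X X\<^esub> \<beta>"
    and star_sharp_le: "\<lbrakk>X \<in> Obj C; Y \<in> Obj C; f \<in> Hom C X Y;
          \<alpha> \<in> kl_Hom C T X X; \<beta> \<in> kl_Hom C T Y Y;
          kl_comp C T Y (sharp C T Y f) \<alpha> \<sqsubseteq>\<^bsub>K X Y\<^esub> kl_comp C T Y \<beta> (sharp C T Y f)\<rbrakk>
          \<Longrightarrow> kl_comp C T Y (sharp C T Y f) (star X \<alpha>)
              \<sqsubseteq>\<^bsub>K X Y\<^esub> kl_comp C T Y (star Y \<beta>) (sharp C T Y f)"
    and star_sharp_ge: "\<lbrakk>X \<in> Obj C; Y \<in> Obj C; f \<in> Hom C X Y;
          \<alpha> \<in> kl_Hom C T X X; \<beta> \<in> kl_Hom C T Y Y;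
          kl_comp C T Y \<beta> (sharp C T Y f) \<sqsubseteq>\<^bsub>K X Y\<^esub> kl_comp C T Y (sharp C T Y f) \<alpha>\<rbrakk>
          \<Longrightarrow> kl_comp C T Y (star Y \<beta>) (sharp C T Y f)
              \<sqsubseteq>\<^bsub>K X Y\<^esub> kl_comp C T Y (sharp C T Y f) (star X \<alpha>)"

text \<open>The empty set is included, so a bottom element is required.\<close>

definition has_finite_joins :: "'a gorder \<Rightarrow> bool"
  where "has_finite_joins L \<longleftrightarrow>
    (\<forall>A. finite A \<and> A \<subseteq> carrier L \<longrightarrow> (\<exists>s. least L s (Upper L A)))"

end

theory Submission
  imports Defs
begin

text \<open>If \<open>1 \<le> \<gamma>\<close> and \<open>\<gamma> \<cdot> \<alpha> \<le> \<gamma>\<close>, then \<open>\<gamma> \<cdot> \<alpha> \<le> 1 \<cdot> \<gamma>\<close>, so the strengthened saturation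
  axiom, applied to the Kleisli arrow \<open>\<gamma>\<close> itself, yields
  \<open>\<alpha>\<^sup>* \<le> \<gamma> \<cdot> \<alpha>\<^sup>* \<le> 1\<^sup>* \<cdot> \<gamma> = \<gamma>\<close>. Hence \<open>\<alpha>\<^sup>*\<close> lies below every prefixed point of
  \<open>x \<mapsto> 1 \<or> x \<cdot> \<alpha>\<close>. Since \<open>\<alpha>\<^sup>*\<close> is itself a prefixed point, so is
  \<open>1 \<or> \<alpha>\<^sup>* \<cdot> \<alpha>\<close>, which makes \<open>\<alpha>\<^sup>*\<close> a fixed point.\<close>

text \<open>The join of HOL-Algebra is a Hilbert choice among least upper bounds; the existence
  hypothesis, applied to the pair, makes that choice a genuine one.\<close>

lemma has_finite_joins_join_least:
  assumes "has_finite_joins L" "x \<in> carrier L" "y \<in> carrier L"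
  shows "least L (x \<squnion>\<^bsub>L\<^esub> y) (Upper L {x, y})"
proof -
  have "\<exists>s. least L s (Upper L {x, y})"
    using assms unfolding has_finite_joins_def by simp
  then show ?thesis
    unfolding join_def sup_def by (rule someI_ex)
qed

context ordered_saturation_monad
begin

text \<open>The identity is reflexive and idempotent, so minimality of the saturation applies with
  \<beta> = 1.\<close>

lemma star_kl_id_le:
  assumes "X \<in> Obj C"
  shows "star X (kl_id T X) \<sqsubseteq>\<^bsub>K X X\<^esub> kl_id T X"
proof -
  interpret partial_order "K X X" using assms by (intro K_partial_order)
  have "kl_id T X \<in> carrier (K X X)" using assms by (simp add: K_carrier kl_id_Hom)
  then show ?thesis
    using assms by (intro star_least) (simp_all add: kl_id_Hom kl_comp_id)
qed

text \<open>The locale gives the saturation axiom only along arrows of the form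
  \<open>sharp C T Y f\<close>, and \<gamma> need not be one. The premise \<open>star_le\<close>
  therefore supplies its instance along \<gamma>, with \<beta> left free.\<close>

lemma star_le_prefixed_point:
  assumes star_le: "\<And>\<beta>. \<lbrakk>\<beta> \<in> kl_Hom C T X X;
       kl_comp C T X \<gamma> \<alpha> \<sqsubseteq>\<^bsub>K X X\<^esub> kl_comp C T X \<beta> \<gamma>\<rbrakk>
      \<Longrightarrow> kl_comp C T X \<gamma> (star X \<alpha>) \<sqsubseteq>\<^bsub>K X X\<^esub> kl_comp C T X (star X \<beta>) \<gamma>"
    and X: "X \<in> Obj C" and \<alpha>: "\<alpha> \<in> kl_Hom C T X X" and \<gamma>: "\<gamma> \<in> kl_Hom C T X X"
    and unit: "kl_id T X \<sqsubseteq>\<^bsub>K X X\<^esub> \<gamma>" and step: "kl_comp C T X \<gamma> \<alpha> \<sqsubseteq>\<^bsub>K X X\<^esub> \<gamma>"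
  shows "star X \<alpha> \<sqsubseteq>\<^bsub>K X X\<^esub> \<gamma>"
proof -
  interpret P: partial_order "K X X" using X by (intro K_partial_order)
  note car = K_carrier[OF X X]
  note i = kl_id_Hom[OF X] and s = star_Hom[OF X \<alpha>]
  note si = star_Hom[OF X i]
  have "kl_comp C T X (kl_id T X) (star X \<alpha>) \<sqsubseteq>\<^bsub>K X X\<^esub> kl_comp C T X \<gamma> (star X \<alpha>)"
    using X s i \<gamma> unit by (intro kl_comp_mono[of X X X]) (simp_all add: car)
  then have 1: "star X \<alpha> \<sqsubseteq>\<^bsub>K X X\<^esub> kl_comp C T X \<gamma> (star X \<alpha>)"
    by (simp add: kl_id_comp[OF X X s])
  \<comment> \<open>The choice \<beta> = 1 turns the premise of \<open>star_le\<close> into \<gamma>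
    \<cdot> \<alpha> \<le> \<gamma>, which is \<open>step\<close>.\<close>
  have 2: "kl_comp C T X \<gamma> (star X \<alpha>) \<sqsubseteq>\<^bsub>K X X\<^esub> kl_comp C T X (star X (kl_id T X)) \<gamma>"
    using step by (intro star_le) (simp_all add: i kl_id_comp[OF X X \<gamma>])
  have "kl_comp C T X (star X (kl_id T X)) \<gamma> \<sqsubseteq>\<^bsub>K X X\<^esub> kl_comp C T X (kl_id T X) \<gamma>"
    using X si i \<gamma> star_kl_id_le[OF X] by (intro kl_comp_mono[of X X X]) (simp_all add: car)
  then have 3: "kl_comp C T X (star X (kl_id T X)) \<gamma> \<sqsubseteq>\<^bsub>K X X\<^esub> \<gamma>"
    by (simp add: kl_id_comp[OF X X \<gamma>])
  have gs: "kl_comp C T X \<gamma> (star X \<alpha>) \<in> kl_Hom C T X X"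
    and sg: "kl_comp C T X (star X (kl_id T X)) \<gamma> \<in> kl_Hom C T X X"
    using X s si \<gamma> by (blast intro: kl_comp_Hom)+
  have "star X \<alpha> \<sqsubseteq>\<^bsub>K X X\<^esub> kl_comp C T X (star X (kl_id T X)) \<gamma>"
    using P.le_trans[OF 1 2] s gs sg by (simp add: car)
  then show ?thesis
    using P.le_trans[OF _ 3] s sg \<gamma> by (simp add: car)
qed

end

theorem theorem5p2:
  fixes C :: "('o, 'a) cat_data"
    and T :: "('o, 'a) monad_data"
    and K :: "'o \<Rightarrow> 'o \<Rightarrow> 'a gorder"
    and star :: "'o \<Rightarrow> 'a \<Rightarrow> 'a"
    and X :: 'o
    and \<alpha> :: 'a
  assumes sat: "ordered_saturation_monad C T K star"
    and joins: "\<And>X Y. \<lbrakk>X \<in> Obj C; Y \<in> Obj C\<rbrakk> \<Longrightarrow> has_finite_joins (K X Y)"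
    and star_le: "\<And>X Y \<alpha> f \<beta>.
      \<lbrakk>X \<in> Obj C; Y \<in> Obj C;
       \<alpha> \<in> kl_Hom C T X X; f \<in> kl_Hom C T X Y; \<beta> \<in> kl_Hom C T Y Y;
       kl_comp C T Y f \<alpha> \<sqsubseteq>\<^bsub>K X Y\<^esub> kl_comp C T Y \<beta> f\<rbrakk>
      \<Longrightarrow> kl_comp C T Y f (star X \<alpha>) \<sqsubseteq>\<^bsub>K X Y\<^esub> kl_comp C T Y (star Y \<beta>) f"
    and star_ge: "\<And>X Y \<alpha> f \<beta>.
      \<lbrakk>X \<in> Obj C; Y \<in> Obj C;
       \<alpha> \<in> kl_Hom C T X X; f \<in> kl_Hom C T X Y; \<beta> \<in> kl_Hom C T Y Y;
       kl_comp C T Y \<beta> f \<sqsubseteq>\<^bsub>K X Y\<^esub> kl_comp C T Y f \<alpha>\<rbrakk>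
      \<Longrightarrow> kl_comp C T Y (star Y \<beta>) f \<sqsubseteq>\<^bsub>K X Y\<^esub> kl_comp C T Y f (star X \<alpha>)"
    and X: "X \<in> Obj C"
    and \<alpha>: "\<alpha> \<in> kl_Hom C T X X"
  shows "least (K X X) (star X \<alpha>)
           (fps (K X X) (\<lambda>x. kl_id T X \<squnion>\<^bsub>K X X\<^esub> kl_comp C T X x \<alpha>))"
proof -
  interpret ordered_saturation_monad C T K star by (rule sat)
  interpret P: partial_order "K X X" using X by (intro K_partial_order)
  note car = K_carrier[OF X X]
  note i = kl_id_Hom[OF X] and s = star_Hom[OF X \<alpha>]
  let ?F = "\<lambda>x. kl_id T X \<squnion>\<^bsub>K X X\<^esub> kl_comp C T X x \<alpha>"
  have comp: "kl_comp C T X x \<alpha> \<in> kl_Hom C T X X" if "x \<in> kl_Hom C T X X" for x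
    using X \<alpha> that by (rule kl_comp_Hom)
  have lub: "least (K X X) (?F x) (Upper (K X X) {kl_id T X, kl_comp C T X x \<alpha>})"
    if "x \<in> kl_Hom C T X X" for x
    using joins[OF X X] i comp[OF that] by (intro has_finite_joins_join_least) (simp_all add: car)
  have F_Hom: "?F x \<in> kl_Hom C T X X" if "x \<in> kl_Hom C T X X" for x
    using least_closed[OF lub[OF that]] by (simp add: car)
  have F_upper: "kl_id T X \<sqsubseteq>\<^bsub>K X X\<^esub> ?F x" "kl_comp C T X x \<alpha> \<sqsubseteq>\<^bsub>K X X\<^esub> ?F x"
    if "x \<in> kl_Hom C T X X" for x
    using least_mem[OF lub[OF that]] i comp[OF that] by (auto simp: Upper_def car)
  have F_least: "?F x \<sqsubseteq>\<^bsub>K X X\<^esub> y"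
    if "x \<in> kl_Hom C T X X" "y \<in> kl_Hom C T X X"
      "kl_id T X \<sqsubseteq>\<^bsub>K X X\<^esub> y" "kl_comp C T X x \<alpha> \<sqsubseteq>\<^bsub>K X X\<^esub> y" for x y
    using least_le[OF lub[OF that(1)]] that by (auto simp: Upper_def car)
  have prefixed: "star X \<alpha> \<sqsubseteq>\<^bsub>K X X\<^esub> \<gamma>"
    if "\<gamma> \<in> kl_Hom C T X X" "kl_id T X \<sqsubseteq>\<^bsub>K X X\<^esub> \<gamma>" "kl_comp C T X \<gamma> \<alpha> \<sqsubseteq>\<^bsub>K X X\<^esub> \<gamma>" for \<gamma>
    using star_le_prefixed_point[OF star_le[OF X X \<alpha> that(1)] X \<alpha> that] by blast
  let ?s = "star X \<alpha>"
  note ss = kl_comp_Hom[OF X s s]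
  \<comment> \<open>Monotonicity and \<alpha> \<le> \<open>?s\<close> bound \<open>?s\<close>
    \<cdot> \<alpha> by \<open>?s\<close> \<cdot> \<open>?s\<close>, hence by \<open>?s\<close>: the
    saturation is a prefixed point.\<close>
  have "kl_comp C T X ?s \<alpha> \<sqsubseteq>\<^bsub>K X X\<^esub> kl_comp C T X ?s ?s"
    using X \<alpha> s star_ext[OF X \<alpha>] by (intro kl_comp_mono[of X X X]) (simp_all add: car)
  then have "kl_comp C T X ?s \<alpha> \<sqsubseteq>\<^bsub>K X X\<^esub> ?s"
    using P.le_trans[OF _ star_trans[OF X \<alpha>]] comp[OF s] ss s by (simp add: car)
  then have F_le: "?F ?s \<sqsubseteq>\<^bsub>K X X\<^esub> ?s"
    using s star_refl[OF X \<alpha>] by (intro F_least)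
  \<comment> \<open>As in the Knaster-Tarski argument, \<open>?F ?s\<close> is again prefixed:
    \<open>?F ?s\<close> \<cdot> \<alpha> \<le> \<open>?s\<close> \<cdot> \<alpha> \<le>
    \<open>?F ?s\<close>. Leastness of \<open>?s\<close> among prefixed points then gives the
    reverse inequality.\<close>
  have "kl_comp C T X (?F ?s) \<alpha> \<sqsubseteq>\<^bsub>K X X\<^esub> kl_comp C T X ?s \<alpha>"
    using X \<alpha> s F_Hom[OF s] F_le by (intro kl_comp_mono[of X X X]) (simp_all add: car)
  then have "kl_comp C T X (?F ?s) \<alpha> \<sqsubseteq>\<^bsub>K X X\<^esub> ?F ?s"
    using P.le_trans[OF _ F_upper(2)[OF s]] comp[OF F_Hom[OF s]] comp[OF s] F_Hom[OF s]
    by (simp add: car)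
  then have "?s \<sqsubseteq>\<^bsub>K X X\<^esub> ?F ?s"
    using F_Hom[OF s] F_upper(1)[OF s] by (intro prefixed)
  then have fixed: "?F ?s = ?s"
    using F_le s F_Hom[OF s] by (intro P.le_antisym) (simp_all add: car)
  show ?thesis
    unfolding least_def
  proof (intro conjI ballI)
    show "fps (K X X) ?F \<subseteq> carrier (K X X)"
      by (auto simp: fps_def)
    show "?s \<in> fps (K X X) ?F"
      using s fixed by (simp add: fps_def car)
    fix \<gamma> assume "\<gamma> \<in> fps (K X X) ?F"
    \<comment> \<open>\<open>fps\<close> is stated with the equivalence of the order structure,
      which is equality in a partial order. So \<gamma> is literally the join, and its being an
      upper bound makes it prefixed.\<close>
    then have \<gamma>: "\<gamma> \<in> kl_Hom C T X X" and eq: "?F \<gamma> = \<gamma>"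
      by (auto simp: fps_def car P.eq_is_equal)
    show "?s \<sqsubseteq>\<^bsub>K X X\<^esub> \<gamma>"
      using prefixed[OF \<gamma>] F_upper[OF \<gamma>] unfolding eq by blast
  qed
qed

end
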